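(* Let $A\in\mathcal A$ with $\mu(A)>0$. Then the metric projection $P_{L_p(A;X)}:L_p(S;X)\to L_p(A;X)$ is Fréchet differentiable on $L_p(S;X)$ and, for any $f\in L_p(S;X)$, $$P'_{L_p(A;X)}(f)(h)=h_A,\quad\text{for any } h\in L_p(S;X)\text{ with }h\ne\theta.$$
   Context: Let $(S,\mathcal A,\mu)$ be a positive measure space, $X$ a real uniformly convex and uniformly smooth Banach space, and $1<p<\infty$. $L_p(S;X)$ is the Bochner space of ($\mu$-equivalence classes of) strongly measurable $f:S\to X$ with $\|f\|_{L_p(S;X)}=\left(\int_S\|f(s)\|_X^p\,d\mu(s)\right)^{1/p}<\infty$; it is a uniformly convex and uniformly smooth Banach space. For $A\in\mathcal A$ with $\mu(A)>0$, $L_p(A;X)$ is the closed subspace $\{f\in L_p(S;X): f(s)=\theta \text{ for } \mu\text{-a.e. } s\in S\setminus A\}$ ($\theta$ denotes the zero vector). For $f\in L_p(S;X)$, $f_A$ is defined by $f_A(s)=f(s)$ for $s\in A$ and $f_A(s)=\theta$ for $s\notin A$. For a nonempty closed convex subset $C$ of a uniformly convex and uniformly smooth Banach space $Z$, the metric projection $P_C:Z\to C$ assigns to $x$ the unique point $P_Cx\in C$ with $\|x-P_Cx\|\le\|x-z\|$ for all $z\in C$. $P_C$ is (Gâteaux) directionally differentiable at $x\in Z$ if for every $v\in Z$, $v\neq\theta$, the limit $P_C'(x)(v)=\lim_{t\downarrow0}\frac{P_C(x+tv)-P_C(x)}{t}$ exists (in norm). $P_C$ is called Fréchet differentiable at $x$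 if moreover this limit is attained uniformly for $v$ in the unit sphere of $Z$; it is Fréchet differentiable on a set $D\subseteq Z$ if it is so at every point of $D$. *)

theory Defs
  imports "HOL-Analysis.Analysis"
begin

section \<open>Uniform convexity and uniform smoothness of a real normed space\<close>

definition uniformly_convex :: "'x::real_normed_vector itself \<Rightarrow> bool" where
  "uniformly_convex _ \<longleftrightarrow>
     (\<forall>\<epsilon>::real. 0 < \<epsilon> \<and> \<epsilon> \<le> 2 \<longrightarrow>
        (\<exists>\<delta>>0. \<forall>x y :: 'x. norm x = 1 \<and> norm y = 1 \<and> norm (x - y) \<ge> \<epsilon> \<longrightarrow>
           norm ((x + y) /\<^sub>R 2) \<le> 1 - \<delta>))"

definition uniformly_smooth :: "'x::real_normed_vector itself \<Rightarrow> bool" where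
  "uniformly_smooth _ \<longleftrightarrow>
     (\<forall>\<epsilon>::real. 0 < \<epsilon> \<longrightarrow>
        (\<exists>\<delta>>0. \<forall>x y :: 'x. norm x = 1 \<and> norm y \<le> \<delta> \<longrightarrow>
           norm (x + y) + norm (x - y) \<le> 2 + \<epsilon> * norm y))"

section \<open>Metric projection and differentiability in a normed space given by a carrier\<close>

text \<open>
  The space \<open>L\<^sub>p(S;X)\<close> depends on a measure and an exponent, hence it is not a type.
  The notions below are therefore stated for a normed space given by its underlying set and
  its operations; they are meant for structures that satisfy the normed space axioms.
\<close>

record 'z normed_space =
  vcarrier :: "'z set"
  vadd :: "'z \<Rightarrow> 'z \<Rightarrow> 'z"
  vscale :: "real \<Rightarrow> 'z \<Rightarrow> 'z"
  vzero :: 'z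
  vnorm :: "'z \<Rightarrow> real"

definition vdiff :: "'z normed_space \<Rightarrow> 'z \<Rightarrow> 'z \<Rightarrow> 'z" where
  "vdiff Z x y = vadd Z x (vscale Z (- 1) y)"

definition metric_projection :: "'z normed_space \<Rightarrow> 'z set \<Rightarrow> 'z \<Rightarrow> 'z" where
  "metric_projection Z C x =
     (THE y. y \<in> C \<and> (\<forall>z\<in>C. vnorm Z (vdiff Z x y) \<le> vnorm Z (vdiff Z x z)))"

definition diff_quotient :: "'z normed_space \<Rightarrow> ('z \<Rightarrow> 'z) \<Rightarrow> 'z \<Rightarrow> 'z \<Rightarrow> real \<Rightarrow> 'z" where
  "diff_quotient Z P x v t = vscale Z (1 / t) (vdiff Z (P (vadd Z x (vscale Z t v))) (P x))"

definition has_dir_deriv :: "'z normed_space \<Rightarrow> ('z \<Rightarrow> 'z) \<Rightarrow> 'z \<Rightarrow> 'z \<Rightarrow> 'z \<Rightarrow> bool" where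
  "has_dir_deriv Z P x v d \<longleftrightarrow>
     d \<in> vcarrier Z \<and>
     ((\<lambda>t. vnorm Z (vdiff Z (diff_quotient Z P x v t) d)) \<longlongrightarrow> 0) (at_right 0)"

definition dir_deriv :: "'z normed_space \<Rightarrow> ('z \<Rightarrow> 'z) \<Rightarrow> 'z \<Rightarrow> 'z \<Rightarrow> 'z" where
  "dir_deriv Z P x v = (THE d. has_dir_deriv Z P x v d)"

definition dir_differentiable_at :: "'z normed_space \<Rightarrow> ('z \<Rightarrow> 'z) \<Rightarrow> 'z \<Rightarrow> bool" where
  "dir_differentiable_at Z P x \<longleftrightarrow>
     (\<forall>v\<in>vcarrier Z. v \<noteq> vzero Z \<longrightarrow> (\<exists>d. has_dir_deriv Z P x v d))"

text \<open>
  Frechet differentiability of a metric projection in the sense used here: the one-sided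
  directional derivatives exist and are attained uniformly on the unit sphere. Linearity of the
  derivative is not part of the definition.
\<close>

definition frechet_differentiable_at :: "'z normed_space \<Rightarrow> ('z \<Rightarrow> 'z) \<Rightarrow> 'z \<Rightarrow> bool" where
  "frechet_differentiable_at Z P x \<longleftrightarrow>
     dir_differentiable_at Z P x \<and>
     (\<forall>\<epsilon>::real. 0 < \<epsilon> \<longrightarrow>
        (\<exists>\<delta>>0. \<forall>t v. 0 < t \<and> t < \<delta> \<and> v \<in> vcarrier Z \<and> vnorm Z v = 1 \<longrightarrow>
           vnorm Z (vdiff Z (diff_quotient Z P x v t) (dir_deriv Z P x v)) < \<epsilon>))"

definition frechet_differentiable_on :: "'z normed_space \<Rightarrow> ('z \<Rightarrow> 'z) \<Rightarrow> 'z set \<Rightarrow> bool" where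
  "frechet_differentiable_on Z P D \<longleftrightarrow> (\<forall>x\<in>D. frechet_differentiable_at Z P x)"

section \<open>The Bochner space of p-integrable functions\<close>

text \<open>
  The library's \<^const>\<open>borel_measurable\<close> does not imply an (almost) separable range,
  so for a possibly nonseparable \<open>X\<close> strong measurability has to be defined separately.
\<close>

definition strongly_measurable :: "'s measure \<Rightarrow> ('s \<Rightarrow> 'x::topological_space) \<Rightarrow> bool" where
  "strongly_measurable M f \<longleftrightarrow>
     (\<exists>u :: nat \<Rightarrow> 's \<Rightarrow> 'x. (\<forall>n. simple_function M (u n)) \<and>
        (\<forall>s\<in>space M. (\<lambda>n. u n s) \<longlonglongrightarrow> f s))"

definition Lp_fun :: "'s measure \<Rightarrow> real \<Rightarrow> ('s \<Rightarrow> 'x::real_normed_vector) set" where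
  "Lp_fun M p = {f. strongly_measurable M f \<and> (\<integral>\<^sup>+ s. ennreal (norm (f s) powr p) \<partial>M) < \<infinity>}"

definition Lp_seminorm :: "'s measure \<Rightarrow> real \<Rightarrow> ('s \<Rightarrow> 'x::real_normed_vector) \<Rightarrow> real" where
  "Lp_seminorm M p f = enn2real (\<integral>\<^sup>+ s. ennreal (norm (f s) powr p) \<partial>M) powr (1 / p)"

definition Lp_rel :: "'s measure \<Rightarrow> real \<Rightarrow> (('s \<Rightarrow> 'x::real_normed_vector) \<times> ('s \<Rightarrow> 'x)) set" where
  "Lp_rel M p = {(f, g). f \<in> Lp_fun M p \<and> g \<in> Lp_fun M p \<and> (AE s in M. f s = g s)}"

definition Lp_class :: "'s measure \<Rightarrow> real \<Rightarrow> ('s \<Rightarrow> 'x::real_normed_vector) \<Rightarrow> ('s \<Rightarrow> 'x) set" where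
  "Lp_class M p f = Lp_rel M p `` {f}"

text \<open>
  The operations on equivalence classes are induced by representatives; the unions and the
  image under \<^const>\<open>the_elem\<close> below are over families that are constant.
\<close>

definition Lp_space :: "'s measure \<Rightarrow> real \<Rightarrow> ('s \<Rightarrow> 'x::real_normed_vector) set normed_space" where
  "Lp_space M p =
     \<lparr> vcarrier = Lp_fun M p // Lp_rel M p,
       vadd = (\<lambda>F G. \<Union>f\<in>F. \<Union>g\<in>G. Lp_class M p (\<lambda>s. f s + g s)),
       vscale = (\<lambda>c F. \<Union>f\<in>F. Lp_class M p (\<lambda>s. c *\<^sub>R f s)),
       vzero = Lp_class M p (\<lambda>s. 0),
       vnorm = (\<lambda>F. the_elem (Lp_seminorm M p ` F)) \<rparr>"

definition Lp_subspace ::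
  "'s measure \<Rightarrow> real \<Rightarrow> 's set \<Rightarrow> ('s \<Rightarrow> 'x::real_normed_vector) set set" where
  "Lp_subspace M p A =
     {Lp_class M p f | f. f \<in> Lp_fun M p \<and> (AE s in M. s \<notin> A \<longrightarrow> f s = 0)}"

definition cut_off :: "'s set \<Rightarrow> ('s \<Rightarrow> 'x::zero) \<Rightarrow> 's \<Rightarrow> 'x" where
  "cut_off A f = (\<lambda>s. if s \<in> A then f s else 0)"

end

(*
  The p-th power of the norm splits as the integral over A plus the integral over the complement
  of A, and every element of the subspace vanishes on the complement. Hence the distance from f
  to g is at least the norm of f restricted to the complement of A, with equality only for
  g = f almost everywhere on A: the metric projection is the cut-off f -> f_A. The cut-off is linear, so all its
  difference quotients in direction h coincide with h_A, and the limit is trivially uniform.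
*)
theory Submission
  imports Defs
begin

section \<open>Strong measurability under pointwise operations\<close>

lemma strongly_measurable_add:
  fixes f g :: "'s \<Rightarrow> 'x::real_normed_vector"
  assumes "strongly_measurable M f" and "strongly_measurable M g"
  shows "strongly_measurable M (\<lambda>s. f s + g s)"
proof -
  from assms obtain u v where
    "\<forall>n. simple_function M (u n)" "\<forall>s\<in>space M. (\<lambda>n. u n s) \<longlonglongrightarrow> f s"
    "\<forall>n. simple_function M (v n)" "\<forall>s\<in>space M. (\<lambda>n. v n s) \<longlonglongrightarrow> g s"
    unfolding strongly_measurable_def by blast
  then show ?thesis
    unfolding strongly_measurable_def
    by (intro exI[of _ "\<lambda>n s. u n s + v n s"])
      (auto intro: simple_function_compose2 tendsto_add)
qed

lemma strongly_measurable_scaleR: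
  fixes f :: "'s \<Rightarrow> 'x::real_normed_vector"
  assumes "strongly_measurable M f"
  shows "strongly_measurable M (\<lambda>s. c *\<^sub>R f s)"
proof -
  from assms obtain u where
    "\<forall>n. simple_function M (u n)" "\<forall>s\<in>space M. (\<lambda>n. u n s) \<longlonglongrightarrow> f s"
    unfolding strongly_measurable_def by blast
  then show ?thesis
    unfolding strongly_measurable_def
    by (intro exI[of _ "\<lambda>n s. c *\<^sub>R u n s"])
      (auto intro: simple_function_compose1 tendsto_intros)
qed

lemma strongly_measurable_cut_off:
  fixes f :: "'s \<Rightarrow> 'x::real_normed_vector"
  assumes "strongly_measurable M f" and "A \<in> sets M"
  shows "strongly_measurable M (cut_off A f)"
proof -
  from assms obtain u where
    "\<forall>n. simple_function M (u n)" "\<forall>s\<in>space M. (\<lambda>n. u n s) \<longlonglongrightarrow> f s"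
    unfolding strongly_measurable_def by blast
  then show ?thesis
    unfolding strongly_measurable_def cut_off_def using assms(2)
    by (intro exI[of _ "\<lambda>n s. if s \<in> A then u n s else 0"])
      (auto intro: simple_function_If_set)
qed

text \<open>The integrals below see a function only through its pointwise norm. The norms of the
  simple approximants are real simple functions, and continuity of the norm passes to the
  limit.\<close>

lemma strongly_measurable_norm:
  fixes f :: "'s \<Rightarrow> 'x::real_normed_vector"
  assumes "strongly_measurable M f"
  shows "(\<lambda>s. norm (f s)) \<in> borel_measurable M"
proof -
  from assms obtain u where
    u: "\<forall>n. simple_function M (u n)" "\<forall>s\<in>space M. (\<lambda>n. u n s) \<longlonglongrightarrow> f s"
    unfolding strongly_measurable_def by blast
  show ?thesis
  proof (rule borel_measurable_LIMSEQ_real)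
    show "(\<lambda>n. norm (u n s)) \<longlonglongrightarrow> norm (f s)" if "s \<in> space M" for s
      using u(2) that by (auto intro: tendsto_norm)
    show "(\<lambda>s. norm (u n s)) \<in> borel_measurable M" for n
      using u(1) by (auto intro: borel_measurable_simple_function simple_function_compose1)
  qed
qed

section \<open>Closure properties of the set of p-integrable functions\<close>

lemma Lp_fun_measurable:
  assumes "f \<in> Lp_fun M p"
  shows "(\<lambda>s. ennreal (norm (f s) powr p)) \<in> borel_measurable M"
  using strongly_measurable_norm[of M f] assms by (auto simp: Lp_fun_def)

text \<open>A crude replacement for Minkowski's inequality: the sum of two norms is at most twice
  their maximum, and the p-th power of the maximum is one of the two summands. The constant is
  harmless, since the bound only serves to show that an integral is finite.\<close>

lemma norm_add_powr_le:
  fixes x y :: "'x::real_normed_vector"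
  assumes "0 \<le> p"
  shows "norm (x + y) powr p \<le> 2 powr p * (norm x powr p + norm y powr p)"
proof -
  have "norm (x + y) powr p \<le> (2 * max (norm x) (norm y)) powr p"
    using norm_triangle_ineq[of x y] assms by (intro powr_mono2) auto
  also have "\<dots> = 2 powr p * max (norm x) (norm y) powr p"
    by (simp add: powr_mult)
  also have "\<dots> \<le> 2 powr p * (norm x powr p + norm y powr p)"
    by (intro mult_left_mono) (auto simp: max_def)
  finally show ?thesis .
qed

lemma Lp_fun_add:
  assumes "f \<in> Lp_fun M p" and "g \<in> Lp_fun M p" and "0 \<le> p"
  shows "(\<lambda>s. f s + g s) \<in> Lp_fun M p"
proof -
  have "(\<integral>\<^sup>+ s. ennreal (norm (f s + g s) powr p) \<partial>M)
      \<le> (\<integral>\<^sup>+ s. ennreal (2 powr p) *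
        (ennreal (norm (f s) powr p) + ennreal (norm (g s) powr p)) \<partial>M)"
    using norm_add_powr_le[OF assms(3)]
    by (intro nn_integral_mono)
      (simp add: ennreal_leI flip: ennreal_mult ennreal_plus)
  also have "\<dots> = ennreal (2 powr p) *
      ((\<integral>\<^sup>+ s. ennreal (norm (f s) powr p) \<partial>M) + (\<integral>\<^sup>+ s. ennreal (norm (g s) powr p) \<partial>M))"
    by (simp only: nn_integral_cmult nn_integral_add borel_measurable_add
        Lp_fun_measurable[OF assms(1)] Lp_fun_measurable[OF assms(2)])
  also have "\<dots> < \<infinity>"
    using assms by (simp add: Lp_fun_def ennreal_mult_less_top)
  finally show ?thesis
    using assms by (simp add: Lp_fun_def strongly_measurable_add)
qed

lemma Lp_fun_scaleR:
  assumes "f \<in> Lp_fun M p"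
  shows "(\<lambda>s. c *\<^sub>R f s) \<in> Lp_fun M p"
proof -
  have "(\<integral>\<^sup>+ s. ennreal (norm (c *\<^sub>R f s) powr p) \<partial>M)
      = (\<integral>\<^sup>+ s. ennreal (\<bar>c\<bar> powr p) * ennreal (norm (f s) powr p) \<partial>M)"
    by (simp add: powr_mult ennreal_mult)
  also have "\<dots> = ennreal (\<bar>c\<bar> powr p) * (\<integral>\<^sup>+ s. ennreal (norm (f s) powr p) \<partial>M)"
    by (rule nn_integral_cmult[OF Lp_fun_measurable[OF assms]])
  also have "\<dots> < \<infinity>"
    using assms by (simp add: Lp_fun_def ennreal_mult_less_top)
  finally show ?thesis
    using assms by (simp add: Lp_fun_def strongly_measurable_scaleR)
qed

lemma Lp_fun_diff:
  assumes "f \<in> Lp_fun M p" and "g \<in> Lp_fun M p" and "0 \<le> p"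
  shows "(\<lambda>s. f s - g s) \<in> Lp_fun M p"
  using Lp_fun_add[OF assms(1) Lp_fun_scaleR[OF assms(2), of "-1"] assms(3)] by simp

lemma Lp_fun_cut_off:
  assumes "f \<in> Lp_fun M p" and "A \<in> sets M"
  shows "cut_off A f \<in> Lp_fun M p"
proof -
  have "(\<integral>\<^sup>+ s. ennreal (norm (cut_off A f s) powr p) \<partial>M)
      \<le> (\<integral>\<^sup>+ s. ennreal (norm (f s) powr p) \<partial>M)"
    by (intro nn_integral_mono) (auto simp: cut_off_def)
  also have "\<dots> < \<infinity>"
    using assms by (simp add: Lp_fun_def)
  finally show ?thesis
    using assms by (simp add: Lp_fun_def strongly_measurable_cut_off)
qed

section \<open>Operations on equivalence classes, computed on representatives\<close>

lemma equiv_Lp_rel: "equiv (Lp_fun M p) (Lp_rel M p)"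
  by (rule equivI) (auto simp: Lp_rel_def refl_on_def intro!: symI transI)

lemma mem_Lp_class:
  assumes "f \<in> Lp_fun M p"
  shows "g \<in> Lp_class M p f \<longleftrightarrow> g \<in> Lp_fun M p \<and> (AE s in M. f s = g s)"
  using assms by (simp add: Lp_class_def Lp_rel_def)

lemma Lp_class_eq_iff:
  assumes "f \<in> Lp_fun M p" and "g \<in> Lp_fun M p"
  shows "Lp_class M p f = Lp_class M p g \<longleftrightarrow> (AE s in M. f s = g s)"
  using eq_equiv_class_iff[OF equiv_Lp_rel, of f M p g] assms
  by (simp add: Lp_class_def Lp_rel_def)

lemma Lp_class_self: "f \<in> Lp_fun M p \<Longrightarrow> f \<in> Lp_class M p f"
  by (simp add: mem_Lp_class)

lemma vcarrier_Lp_space: "vcarrier (Lp_space M p) = Lp_class M p ` Lp_fun M p"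
  by (auto simp: Lp_space_def quotient_def Lp_class_def)

text \<open>Other representatives change the sum only on a null set, so the union in the definition
  of \<open>vadd\<close> runs over a constant family.\<close>

lemma vadd_Lp_class:
  assumes "f \<in> Lp_fun M p" and "g \<in> Lp_fun M p" and "0 \<le> p"
  shows "vadd (Lp_space M p) (Lp_class M p f) (Lp_class M p g) = Lp_class M p (\<lambda>s. f s + g s)"
proof -
  have "Lp_class M p (\<lambda>s. f' s + g' s) = Lp_class M p (\<lambda>s. f s + g s)"
    if "f' \<in> Lp_class M p f" "g' \<in> Lp_class M p g" for f' g'
  proof (subst Lp_class_eq_iff)
    show "AE s in M. f' s + g' s = f s + g s"
      using that assms by (auto simp: mem_Lp_class)
  qed (use that assms in \<open>auto simp: mem_Lp_class intro: Lp_fun_add\<close>)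
  \<comment> \<open>Nonempty index sets make the union of the constant family equal to its common
    value rather than empty.\<close>
  moreover have "f \<in> Lp_class M p f" "g \<in> Lp_class M p g"
    using assms by (auto intro: Lp_class_self)
  ultimately show ?thesis
    unfolding Lp_space_def normed_space.select_convs by blast
qed

lemma vscale_Lp_class:
  assumes "f \<in> Lp_fun M p"
  shows "vscale (Lp_space M p) c (Lp_class M p f) = Lp_class M p (\<lambda>s. c *\<^sub>R f s)"
proof -
  have "Lp_class M p (\<lambda>s. c *\<^sub>R f' s) = Lp_class M p (\<lambda>s. c *\<^sub>R f s)"
    if "f' \<in> Lp_class M p f" for f'
  proof (subst Lp_class_eq_iff)
    show "AE s in M. c *\<^sub>R f' s = c *\<^sub>R f s"
      using that assms by (auto simp: mem_Lp_class)
  qed (use that assms in \<open>auto simp: mem_Lp_class intro: Lp_fun_scaleR\<close>)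
  moreover have "f \<in> Lp_class M p f"
    using assms by (rule Lp_class_self)
  ultimately show ?thesis
    unfolding Lp_space_def normed_space.select_convs by blast
qed

lemma vdiff_Lp_class:
  assumes "f \<in> Lp_fun M p" and "g \<in> Lp_fun M p" and "0 \<le> p"
  shows "vdiff (Lp_space M p) (Lp_class M p f) (Lp_class M p g) = Lp_class M p (\<lambda>s. f s - g s)"
  using assms
  by (simp add: vdiff_def vscale_Lp_class vadd_Lp_class Lp_fun_scaleR[of g M p "-1", simplified])

text \<open>The integral ignores null sets, so the image of a class under the seminorm is a
  singleton and \<open>the_elem\<close> returns a meaningful value.\<close>

lemma vnorm_Lp_class:
  assumes "f \<in> Lp_fun M p"
  shows "vnorm (Lp_space M p) (Lp_class M p f) = Lp_seminorm M p f"
proof -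
  have "Lp_seminorm M p g = Lp_seminorm M p f" if "g \<in> Lp_class M p f" for g
  proof -
    have "(\<integral>\<^sup>+ s. ennreal (norm (g s) powr p) \<partial>M) = (\<integral>\<^sup>+ s. ennreal (norm (f s) powr p) \<partial>M)"
      using that assms by (intro nn_integral_cong_AE) (auto simp: mem_Lp_class)
    then show ?thesis
      by (simp add: Lp_seminorm_def)
  qed
  then have "Lp_seminorm M p ` Lp_class M p f = {Lp_seminorm M p f}"
    using Lp_class_self[OF assms] by blast
  then show ?thesis
    by (simp add: Lp_space_def)
qed

section \<open>From norms to integrals of p-th powers\<close>

lemma Lp_seminorm_le_iff:
  assumes "f \<in> Lp_fun M p" and "g \<in> Lp_fun M p" and "0 < p"
  shows "Lp_seminorm M p f \<le> Lp_seminorm M p g \<longleftrightarrow>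
    (\<integral>\<^sup>+ s. ennreal (norm (f s) powr p) \<partial>M) \<le> (\<integral>\<^sup>+ s. ennreal (norm (g s) powr p) \<partial>M)"
proof -
  \<comment> \<open>Strict monotonicity of the root on nonnegative reals gives the direction from
    left to right by contraposition.\<close>
  have powr_le: "x powr (1 / p) \<le> y powr (1 / p) \<longleftrightarrow> x \<le> y" if "0 \<le> x" "0 \<le> y" for x y :: real
    using that assms(3) powr_mono2[of "1 / p" x y] powr_less_mono2[of "1 / p" y x]
    by (auto simp: not_le[symmetric])
  show ?thesis
    \<comment> \<open>Both integrals are finite, so \<open>enn2real\<close> preserves and reflects
      their order.\<close>
    using assms(1,2) unfolding Lp_seminorm_def Lp_fun_def
    by (subst powr_le) (auto simp: enn2real_nonneg simp flip: ennreal_le_iff)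
qed

text \<open>Since \<open>enn2real\<close> sends infinity to 0 as well, finiteness of the integral is
  what makes a zero seminorm informative. For every exponent, \<open>powr\<close> vanishes exactly
  when its base is 0.\<close>

lemma Lp_seminorm_eq_0_iff:
  assumes "f \<in> Lp_fun M p"
  shows "Lp_seminorm M p f = 0 \<longleftrightarrow> (AE s in M. f s = 0)"
  using assms Lp_fun_measurable[OF assms]
  by (auto simp: Lp_seminorm_def Lp_fun_def enn2real_eq_0_iff nn_integral_0_iff_AE)

text \<open>At each point one of the two integrands on the right is 0 and the other equals the
  integrand on the left.\<close>

lemma nn_integral_cut_off_split:
  assumes "f \<in> Lp_fun M p" and "A \<in> sets M"
  shows "(\<integral>\<^sup>+ s. ennreal (norm (f s) powr p) \<partial>M) =
    (\<integral>\<^sup>+ s. ennreal (norm (cut_off A f s) powr p) \<partial>M) +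
    (\<integral>\<^sup>+ s. ennreal (norm (f s - cut_off A f s) powr p) \<partial>M)"
proof -
  note [measurable] = Lp_fun_measurable[OF assms(1)] assms(2)
  \<comment> \<open>Additivity of the integral asks for measurable integrands; the part off
    \<open>A\<close> gets this from its form as a product with an indicator.\<close>
  have "(\<lambda>s. ennreal (norm (f s) powr p) * indicator (- A) s) \<in> borel_measurable M"
    by measurable
  moreover have "(\<lambda>s. ennreal (norm (f s - cut_off A f s) powr p)) =
      (\<lambda>s. ennreal (norm (f s) powr p) * indicator (- A) s)"
    by (auto simp: cut_off_def fun_eq_iff indicator_def)
  ultimately show ?thesis
    using Lp_fun_measurable[OF Lp_fun_cut_off[OF assms]]
    by (subst nn_integral_add[symmetric]) (auto simp: cut_off_def intro!: nn_integral_cong)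
qed

section \<open>The metric projection as a cut-off\<close>

lemma metric_projection_Lp_subspace:
  fixes f :: "'s \<Rightarrow> 'x::real_normed_vector"
  assumes "0 < p" and A: "A \<in> sets M" and f: "f \<in> Lp_fun M p"
  shows "metric_projection (Lp_space M p) (Lp_subspace M p A) (Lp_class M p f) =
    Lp_class M p (cut_off A f)"
  unfolding metric_projection_def
proof (rule the_equality)
  let ?I = "\<lambda>f. \<integral>\<^sup>+ s. ennreal (norm (f s) powr p) \<partial>M"
  let ?d = "\<lambda>g. vnorm (Lp_space M p) (vdiff (Lp_space M p) (Lp_class M p f) (Lp_class M p g))"
  have p: "0 \<le> p" using assms(1) by simp
  have fA: "cut_off A f \<in> Lp_fun M p"
    using f A by (rule Lp_fun_cut_off)
  have mem: "Lp_class M p (cut_off A f) \<in> Lp_subspace M p A"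
    unfolding Lp_subspace_def using fA by (auto simp: cut_off_def)
  have le_iff: "?d g \<le> ?d h \<longleftrightarrow> ?I (\<lambda>s. f s - g s) \<le> ?I (\<lambda>s. f s - h s)"
    if "g \<in> Lp_fun M p" "h \<in> Lp_fun M p" for g h
    using that f assms(1) p
    by (simp add: vdiff_Lp_class vnorm_Lp_class Lp_fun_diff Lp_seminorm_le_iff)
  \<comment> \<open>The second summand does not involve \<open>g\<close>, because \<open>g\<close>
    vanishes almost everywhere off \<open>A\<close>. Minimising the distance thus means minimising
    the first summand.\<close>
  have split: "?I (\<lambda>s. f s - g s) =
      ?I (cut_off A (\<lambda>s. f s - g s)) + ?I (\<lambda>s. f s - cut_off A f s)"
    if "g \<in> Lp_fun M p" "AE s in M. s \<notin> A \<longrightarrow> g s = 0" for g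
  proof -
    have "?I (\<lambda>s. (f s - g s) - cut_off A (\<lambda>s. f s - g s) s) = ?I (\<lambda>s. f s - cut_off A f s)"
      using that(2) by (intro nn_integral_cong_AE) (auto simp: cut_off_def)
    then show ?thesis
      using nn_integral_cut_off_split[OF Lp_fun_diff[OF f that(1) p] A] by simp
  qed
  show "Lp_class M p (cut_off A f) \<in> Lp_subspace M p A \<and>
    (\<forall>z\<in>Lp_subspace M p A. ?d (cut_off A f) \<le>
      vnorm (Lp_space M p) (vdiff (Lp_space M p) (Lp_class M p f) z))"
  proof (intro conjI mem ballI)
    fix z :: "('s \<Rightarrow> 'x) set" assume "z \<in> Lp_subspace M p A"
    then obtain g where g: "z = Lp_class M p g" "g \<in> Lp_fun M p" "AE s in M. s \<notin> A \<longrightarrow> g s = 0"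
      unfolding Lp_subspace_def by blast
    \<comment> \<open>For \<open>cut_off A f\<close> the integral is exactly the constant summand of
      \<open>split\<close>; any other \<open>g\<close> adds a nonnegative term.\<close>
    show "?d (cut_off A f) \<le> vnorm (Lp_space M p) (vdiff (Lp_space M p) (Lp_class M p f) z)"
      using g fA by (simp add: le_iff split)
  qed
  fix y :: "('s \<Rightarrow> 'x) set"
  assume y: "y \<in> Lp_subspace M p A \<and> (\<forall>z\<in>Lp_subspace M p A.
      vnorm (Lp_space M p) (vdiff (Lp_space M p) (Lp_class M p f) y)
      \<le> vnorm (Lp_space M p) (vdiff (Lp_space M p) (Lp_class M p f) z))"
  then obtain g where g: "y = Lp_class M p g" "g \<in> Lp_fun M p" "AE s in M. s \<notin> A \<longrightarrow> g s = 0"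
    unfolding Lp_subspace_def by blast
  have fg: "cut_off A (\<lambda>s. f s - g s) \<in> Lp_fun M p"
    using f g(2) p A by (intro Lp_fun_cut_off Lp_fun_diff)
  have "?d g \<le> ?d (cut_off A f)"
    using y mem g(1) by blast
  then have "?I (cut_off A (\<lambda>s. f s - g s)) + ?I (\<lambda>s. f s - cut_off A f s)
      \<le> ?I (\<lambda>s. f s - cut_off A f s)"
    using g fA by (simp add: le_iff split)
  \<comment> \<open>A common summand in \<open>ennreal\<close> may be cancelled only if it is
    finite.\<close>
  moreover have "?I (\<lambda>s. f s - cut_off A f s) < \<infinity>"
    using Lp_fun_diff[OF f fA p] by (simp add: Lp_fun_def)
  ultimately have "?I (cut_off A (\<lambda>s. f s - g s)) = 0"
    using ennreal_add_left_cancel_le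
      [of "?I (\<lambda>s. f s - cut_off A f s)" "?I (cut_off A (\<lambda>s. f s - g s))" 0]
    by (auto simp: add.commute)
  then have "AE s in M. cut_off A (\<lambda>s. f s - g s) s = 0"
    using Lp_seminorm_eq_0_iff[OF fg] by (simp add: Lp_seminorm_def)
  \<comment> \<open>On \<open>A\<close> the vanishing cut-off difference gives g = f; off
    \<open>A\<close> both sides are 0.\<close>
  with g(3) have "AE s in M. g s = cut_off A f s"
    by eventually_elim (auto simp: cut_off_def split: if_splits)
  then show "y = Lp_class M p (cut_off A f)"
    using g fA by (simp add: Lp_class_eq_iff)
qed

section \<open>Differentiability of the projection\<close>

lemma vnorm_vdiff_Lp_class_eq_0_iff:
  assumes "0 \<le> p" and "f \<in> Lp_fun M p" and "g \<in> Lp_fun M p"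
  shows "vnorm (Lp_space M p) (vdiff (Lp_space M p) (Lp_class M p f) (Lp_class M p g)) = 0
    \<longleftrightarrow> Lp_class M p f = Lp_class M p g"
  using assms
  by (simp add: vdiff_Lp_class vnorm_Lp_class Lp_fun_diff Lp_seminorm_eq_0_iff Lp_class_eq_iff)

lemma diff_quotient_metric_projection_Lp_subspace:
  assumes "0 < p" and A: "A \<in> sets M" and f: "f \<in> Lp_fun M p" and h: "h \<in> Lp_fun M p"
    and "t \<noteq> 0"
  shows "diff_quotient (Lp_space M p) (metric_projection (Lp_space M p) (Lp_subspace M p A))
    (Lp_class M p f) (Lp_class M p h) t = Lp_class M p (cut_off A h)"
proof -
  have p: "0 \<le> p" using assms(1) by simp
  have fth: "(\<lambda>s. f s + t *\<^sub>R h s) \<in> Lp_fun M p"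
    using f h p by (intro Lp_fun_add Lp_fun_scaleR)
  \<comment> \<open>Linearity of the cut-off, checked pointwise: on \<open>A\<close> the terms in
    \<open>f\<close> cancel and then the factor \<open>t\<close>; off \<open>A\<close> everything is
    0.\<close>
  have "(\<lambda>s. (1 / t) *\<^sub>R (cut_off A (\<lambda>s. f s + t *\<^sub>R h s) s - cut_off A f s)) = cut_off A h"
    using assms(5) by (auto simp: cut_off_def fun_eq_iff)
  then show ?thesis
    unfolding diff_quotient_def using fth f h p A assms(1)
    by (simp only: vscale_Lp_class vadd_Lp_class Lp_fun_scaleR metric_projection_Lp_subspace
        vdiff_Lp_class Lp_fun_cut_off Lp_fun_diff)
qed

text \<open>Stating this as an equivalence gives existence and uniqueness of the derivative at once;
  the definite description in \<open>dir_deriv\<close> depends on both.\<close>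

lemma has_dir_deriv_metric_projection_Lp_subspace:
  assumes "0 < p" and A: "A \<in> sets M" and f: "f \<in> Lp_fun M p" and h: "h \<in> Lp_fun M p"
  shows "has_dir_deriv (Lp_space M p) (metric_projection (Lp_space M p) (Lp_subspace M p A))
    (Lp_class M p f) (Lp_class M p h) d \<longleftrightarrow> d = Lp_class M p (cut_off A h)"
proof -
  let ?Z = "Lp_space M p" and ?P = "metric_projection (Lp_space M p) (Lp_subspace M p A)"
  have hA: "cut_off A h \<in> Lp_fun M p"
    using h A by (rule Lp_fun_cut_off)
  \<comment> \<open>The filter \<open>at_right 0\<close> only sees t > 0, where the quotient is
    constant in t. As the filter is nontrivial, a constant tends to 0 only if it is 0, and
    definiteness of the norm then determines \<open>d\<close>.\<close>
  have "((\<lambda>t. vnorm ?Z (vdiff ?Z (diff_quotient ?Z ?P (Lp_class M p f) (Lp_class M p h) t) d))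
      \<longlongrightarrow> 0) (at_right 0) \<longleftrightarrow>
    ((\<lambda>t::real. vnorm ?Z (vdiff ?Z (Lp_class M p (cut_off A h)) d)) \<longlongrightarrow> 0) (at_right 0)"
    using assms
    by (intro tendsto_cong)
      (auto simp: eventually_at_filter diff_quotient_metric_projection_Lp_subspace)
  then show ?thesis
    using hA assms(1) vnorm_vdiff_Lp_class_eq_0_iff[of p "cut_off A h" M]
    by (auto simp: has_dir_deriv_def vcarrier_Lp_space tendsto_const_iff)
qed

lemma dir_deriv_metric_projection_Lp_subspace:
  assumes "0 < p" and "A \<in> sets M" and "f \<in> Lp_fun M p" and "h \<in> Lp_fun M p"
  shows "dir_deriv (Lp_space M p) (metric_projection (Lp_space M p) (Lp_subspace M p A))
    (Lp_class M p f) (Lp_class M p h) = Lp_class M p (cut_off A h)"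
  using assms by (simp add: dir_deriv_def has_dir_deriv_metric_projection_Lp_subspace)

lemma frechet_differentiable_metric_projection_Lp_subspace:
  assumes "0 < p" and A: "A \<in> sets M" and f: "f \<in> Lp_fun M p"
  shows "frechet_differentiable_at (Lp_space M p)
    (metric_projection (Lp_space M p) (Lp_subspace M p A)) (Lp_class M p f)"
  unfolding frechet_differentiable_at_def dir_differentiable_at_def
proof (intro conjI allI impI ballI)
  show "\<exists>d. has_dir_deriv (Lp_space M p) (metric_projection (Lp_space M p) (Lp_subspace M p A))
      (Lp_class M p f) v d" if "v \<in> vcarrier (Lp_space M p)" for v
    using that assms
    by (auto simp: vcarrier_Lp_space has_dir_deriv_metric_projection_Lp_subspace)
  fix \<epsilon> :: real assume "0 < \<epsilon>"
  then show "\<exists>\<delta>>0. \<forall>t v. 0 < t \<and> t < \<delta> \<and> v \<in> vcarrier (Lp_space M p) \<and> vnorm (Lp_space M p) v = 1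
    \<longrightarrow> vnorm (Lp_space M p) (vdiff (Lp_space M p)
      (diff_quotient (Lp_space M p) (metric_projection (Lp_space M p) (Lp_subspace M p A))
        (Lp_class M p f) v t)
      (dir_deriv (Lp_space M p) (metric_projection (Lp_space M p) (Lp_subspace M p A))
        (Lp_class M p f) v)) < \<epsilon>"
    using assms
    \<comment> \<open>Any positive radius would do: the error is exactly 0 for every t > 0 and every
      direction.\<close>
    by (intro exI[of _ 1])
      (auto simp: vcarrier_Lp_space diff_quotient_metric_projection_Lp_subspace
        dir_deriv_metric_projection_Lp_subspace vnorm_vdiff_Lp_class_eq_0_iff[THEN iffD2]
        Lp_fun_cut_off)
qed

theorem theorem5p2:
  fixes M :: "'s measure" and p :: real and A :: "'s set"
  assumes "uniformly_convex TYPE('x::banach)"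
    and "uniformly_smooth TYPE('x)"
    and "1 < p"
    and "A \<in> sets M"
    and "emeasure M A > 0"
  defines "Z \<equiv> (Lp_space M p :: ('s \<Rightarrow> 'x) set normed_space)"
  defines "P \<equiv> metric_projection Z (Lp_subspace M p A)"
  shows "frechet_differentiable_on Z P (vcarrier Z) \<and>
    (\<forall>f\<in>Lp_fun M p. \<forall>h\<in>Lp_fun M p. Lp_class M p h \<noteq> vzero Z \<longrightarrow>
       dir_deriv Z P (Lp_class M p f) (Lp_class M p h) = Lp_class M p (cut_off A h))"
  using assms(3,4)
  by (auto simp: Z_def P_def frechet_differentiable_on_def vcarrier_Lp_space
      frechet_differentiable_metric_projection_Lp_subspace dir_deriv_metric_projection_Lp_subspace)

end
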